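(* As $n\to\infty$, $$k_0(n,3,2)\le 2.95\,\lg n\,(1+o(1)),\qquad k_0(n,4,2)\le 7.23\,\lg n\,(1+o(1)),\qquad k_0(n,3,3)\le 11.77\,\lg n\,(1+o(1)).$$
   Context: $\lg$ denotes $\log_2$. The weight of a word of length $t$ over the alphabet $\{1,\dots,d\}$ is the sum of its $t$ entries, so weights range over the integers $w$ with $t\le w\le dt$. For $n\ge t$, a $k\times n$ array with entries from $\{1,\dots,d\}$ is a covering array for weight-equivalent words of length $t$ over $[d]=\{1,\dots,d\}$ if for each choice of $t$ columns and each integer $w$ with $t\le w\le dt$, a word of weight $w$ appears in at least one of the rows of the selected $t$ columns. $k_0(n,t,d)$ denotes the minimum number $k$ of rows for which such a $k\times n$ array exists. The term $o(1)$ denotes a quantity tending to $0$ as $n\to\infty$. *)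

theory Defs
  imports Complex_Main "HOL-Library.Landau_Symbols"
begin

(* A k x n array is a function A on row indices i < k and column indices j < n;
   its values outside this range are irrelevant. *)
definition array_over :: "nat \<Rightarrow> nat \<Rightarrow> nat \<Rightarrow> (nat \<Rightarrow> nat \<Rightarrow> nat) \<Rightarrow> bool" where
  "array_over k n d A \<longleftrightarrow> (\<forall>i<k. \<forall>j<n. A i j \<in> {1..d})"

(* The weight of the word that row i has in the columns of C; as a sum, it does not
   depend on the order in which the columns are read. *)
definition row_weight :: "(nat \<Rightarrow> nat \<Rightarrow> nat) \<Rightarrow> nat \<Rightarrow> nat set \<Rightarrow> nat" where
  "row_weight A i C = (\<Sum>j\<in>C. A i j)"

definition weight_covering_array ::
  "nat \<Rightarrow> nat \<Rightarrow> nat \<Rightarrow> nat \<Rightarrow> (nat \<Rightarrow> nat \<Rightarrow> nat) \<Rightarrow> bool" where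
  "weight_covering_array k n t d A \<longleftrightarrow>
     array_over k n d A \<and>
     (\<forall>C. C \<subseteq> {..<n} \<and> card C = t \<longrightarrow>
        (\<forall>w\<in>{t..d * t}. \<exists>i<k. row_weight A i C = w))"

(* Meaningful for n \<ge> t and d \<ge> 1, where the array whose rows are all the words of
   length n over {1..d} shows that the minimum exists. *)
definition k0 :: "nat \<Rightarrow> nat \<Rightarrow> nat \<Rightarrow> nat" where
  "k0 n t d = (LEAST k. \<exists>A. weight_covering_array k n t d A)"

(* f n \<le> g n (1 + o(1)) as n tends to infinity *)
definition asymp_le :: "(nat \<Rightarrow> real) \<Rightarrow> (nat \<Rightarrow> real) \<Rightarrow> bool" where
  "asymp_le f g \<longleftrightarrow>
     (\<exists>e :: nat \<Rightarrow> real. e \<in> o(\<lambda>_. 1) \<and> (\<forall>\<^sub>F n in sequentially. f n \<le> g n * (1 + e n)))"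

end

theory Submission
  imports Defs "HOL-Library.FuncSet"
begin

text \<open>
  The weights in \<open>{t..d * t}\<close> that are multiples of \<open>t\<close> cost only \<open>d\<close> rows in total: the
  constant row \<open>a\<close> has weight \<open>t * a\<close> on every choice of \<open>t\<close> columns.  The other weights are the
  less extreme ones, and for them uniformly random rows do well.  If a random word of length \<open>t\<close>
  misses each of these weights with probability at most \<open>1 / b\<close>, then \<open>k\<close> independent random rows
  miss a given weight on a given set of \<open>t\<close> columns with probability at most \<open>1 / b ^ k\<close>.

  A union bound over all \<open>t\<close>-sets of columns would need about \<open>t * log b n\<close> rows.  The method of
  alterations lowers the factor to \<open>t - 1\<close>: start with \<open>2 * n\<close> columns, choose \<open>k\<close> so large that
  the expected number of uncovered pairs (column set, weight) is at most \<open>n\<close>, and delete one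
  column from each of them.  Since there are \<open>O(n ^ t)\<close> pairs, \<open>b ^ k\<close> has to exceed a constant
  multiple of \<open>n ^ (t - 1)\<close> only.  This gives \<open>k0 n t d \<le> (t - 1) * log b n + O(1)\<close>, which is
  \<open>k0_le_log\<close>; the averaging is \<open>exists_array_few_uncovered\<close>, and the deletion together with the
  constant rows is \<open>k0_le_of_few_uncovered\<close>.

  The rarest weights off the multiples of \<open>t\<close> are attained by 3 of 8, 4 of 16 and 3 of 27 words
  in the three cases, so \<open>b\<close> is \<open>8/5\<close>, \<open>4/3\<close> and \<open>9/8\<close>.  The constants 2.95, 7.23 and
  11.77 are \<open>(t - 1) / log 2 b\<close> rounded up.
\<close>

section \<open>Counting words and rows by weight\<close>

fun num_words :: "nat \<Rightarrow> nat \<Rightarrow> nat \<Rightarrow> nat" where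
  "num_words d 0 w = (if w = 0 then 1 else 0)"
| "num_words d (Suc t) w = (\<Sum>a\<in>{1..d}. if a \<le> w then num_words d t (w - a) else 0)"

text \<open>
  The weight distribution of words depends only on the number of positions, so it can be
  computed by the recursion on the value at one position, whatever the column set is.
\<close>

lemma card_words_of_weight:
  assumes "finite C"
  shows "card {g \<in> C \<rightarrow>\<^sub>E {1..d}. sum g C = w} = num_words d (card C) w"
  using assms
proof (induction C arbitrary: w rule: finite_induct)
  case empty
  have "{g \<in> {} \<rightarrow>\<^sub>E {1..d}. sum g {} = w} = (if w = 0 then {\<lambda>x. undefined} else {})"
    by auto
  then show ?case by simp
next
  case (insert x C)
  define G where "G v = {g \<in> C \<rightarrow>\<^sub>E {1..d}. sum g C = v}" for v
  define S where "S a = (if a \<le> w then (\<lambda>g. g(x := a)) ` G (w - a) else {})" for a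
  have finG: "finite (G v)" for v
    unfolding G_def using insert.hyps(1) by (intro finite_Collect_conjI disjI1) (simp add: finite_PiE)
  have sum_upd: "sum (g(x := a)) C = sum g C" for g :: "'a \<Rightarrow> nat" and a
    using insert.hyps(2) by (intro sum.cong) auto
  have "{g \<in> insert x C \<rightarrow>\<^sub>E {1..d}. sum g (insert x C) = w} = (\<Union>a\<in>{1..d}. S a)"
  proof (intro set_eqI iffI)
    fix g assume "g \<in> {g \<in> insert x C \<rightarrow>\<^sub>E {1..d}. sum g (insert x C) = w}"
    then have g: "g \<in> insert x C \<rightarrow>\<^sub>E {1..d}" and w: "g x + sum g C = w"
      using insert.hyps by auto
    have "g(x := undefined) \<in> G (w - g x)"
      using g w insert.hyps sum_upd[of g undefined]
      by (auto simp: G_def PiE_iff extensional_def)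
    then have "g \<in> (\<lambda>g'. g'(x := g x)) ` G (w - g x)"
      by (intro image_eqI[where x = "g(x := undefined)"]) auto
    with g w show "g \<in> (\<Union>a\<in>{1..d}. S a)"
      by (intro UN_I[of "g x"]) (auto simp: S_def)
  next
    fix g assume "g \<in> (\<Union>a\<in>{1..d}. S a)"
    then obtain a h where "a \<in> {1..d}" "a \<le> w" "h \<in> G (w - a)" "g = h(x := a)"
      by (auto simp: S_def split: if_splits)
    then show "g \<in> {g \<in> insert x C \<rightarrow>\<^sub>E {1..d}. sum g (insert x C) = w}"
      using insert.hyps sum_upd[of h a] by (auto simp: G_def PiE_iff extensional_def)
  qed
  moreover have "card (\<Union>a\<in>{1..d}. S a) = (\<Sum>a\<in>{1..d}. card (S a))"
  proof (rule card_UN_disjoint)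
    have "g x = a" if "g \<in> S a" for g a
      using that by (auto simp: S_def split: if_splits)
    then show "\<forall>i\<in>{1..d}. \<forall>j\<in>{1..d}. i \<noteq> j \<longrightarrow> S i \<inter> S j = {}" by blast
  qed (auto simp: S_def finG)
  moreover have "card (S a) = (if a \<le> w then num_words d (card C) (w - a) else 0)" for a
  proof -
    have "inj_on (\<lambda>g. g(x := a)) (G v)" for v
    proof (rule inj_onI)
      fix g h assume gh: "g \<in> G v" "h \<in> G v" "g(x := a) = h(x := a)"
      have "g x = undefined" "h x = undefined"
        using gh(1,2) insert.hyps(2) by (auto simp: G_def PiE_iff extensional_def)
      with gh(3) show "g = h" by (metis fun_upd_triv fun_upd_upd)
    qed
    then show ?thesis
      using insert.IH by (simp add: S_def card_image G_def)
  qed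
  ultimately show ?case using insert.hyps by simp
qed

text \<open>
  Splitting a row into its parts inside and outside \<open>C\<close> leaves the outer part free: restricting a
  uniformly random row to \<open>C\<close> gives a uniformly random word.
\<close>

lemma card_rows_missing_weight:
  assumes "finite V" "C \<subseteq> V"
  shows "card {f \<in> V \<rightarrow>\<^sub>E {1..d}. sum f C \<noteq> w}
           = (d ^ card C - num_words d (card C) w) * d ^ (card V - card C)"
proof -
  let ?M = "{f \<in> V \<rightarrow>\<^sub>E {1..d}. sum f C \<noteq> w}"
  let ?P = "{g \<in> C \<rightarrow>\<^sub>E {1..d}. sum g C \<noteq> w}"
  let ?Q = "(V - C) \<rightarrow>\<^sub>E {1..d}"
  have fin: "finite C" using assms finite_subset by auto
  have "bij_betw (\<lambda>f. (restrict f C, restrict f (V - C))) ?M (?P \<times> ?Q)"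
  proof (rule bij_betw_byWitness[where f' = "\<lambda>(g, h) x. if x \<in> C then g x else h x"])
    show "\<forall>f\<in>?M. (case (restrict f C, restrict f (V - C)) of (g, h) \<Rightarrow> \<lambda>x. if x \<in> C then g x else h x) = f"
      using assms(2) by (auto simp: PiE_iff extensional_def fun_eq_iff)
    show "\<forall>p\<in>?P \<times> ?Q. (\<lambda>f. (restrict f C, restrict f (V - C)))
            (case p of (g, h) \<Rightarrow> \<lambda>x. if x \<in> C then g x else h x) = p"
      by (auto simp: PiE_iff extensional_def fun_eq_iff)
    show "(\<lambda>f. (restrict f C, restrict f (V - C))) ` ?M \<subseteq> ?P \<times> ?Q"
      using assms(2) by (auto simp: PiE_iff split: if_splits)
    show "(\<lambda>(g, h) x. if x \<in> C then g x else h x) ` (?P \<times> ?Q) \<subseteq> ?M"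
      using assms(2) by (auto simp: PiE_iff extensional_def split: if_splits)
  qed
  then have "card ?M = card ?P * card ?Q"
    by (simp add: bij_betw_same_card card_cartesian_product)
  moreover have "?P = (C \<rightarrow>\<^sub>E {1..d}) - {g \<in> C \<rightarrow>\<^sub>E {1..d}. sum g C = w}" by auto
  then have "card ?P = d ^ card C - num_words d (card C) w"
    using fin by (simp add: card_Diff_subset finite_PiE card_PiE card_words_of_weight del: One_nat_def)
  moreover have "card ?Q = d ^ (card V - card C)"
    using assms fin by (simp add: card_PiE card_Diff_subset)
  ultimately show ?thesis by simp
qed

section \<open>Few uncovered pairs on average\<close>

definition uncovered :: "nat \<Rightarrow> nat set \<Rightarrow> nat \<Rightarrow> nat set \<Rightarrow> (nat \<Rightarrow> nat \<Rightarrow> nat) \<Rightarrow> (nat set \<times> nat) set"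
  where "uncovered k V t W A =
    {(C, w). C \<subseteq> V \<and> card C = t \<and> w \<in> W \<and> (\<forall>i<k. row_weight A i C \<noteq> w)}"

text \<open>
  The expectation argument, written as a count over the finite set of all arrays: exchanging
  the two sums shows that the average number of uncovered pairs is at most the stated bound, so
  not every array can exceed it.  The hypothesis \<open>freq\<close> says that a random word misses the weight
  \<open>w\<close> with probability at most \<open>1 / b\<close>.
\<close>

lemma exists_array_few_uncovered:
  fixes b :: real
  assumes V: "finite V" and W: "finite W" and d: "d \<ge> 1" and b: "b > 0"
    and freq: "\<And>w. w \<in> W \<Longrightarrow> b * (real d ^ t - real (num_words d t w)) \<le> real d ^ t"
  shows "\<exists>A. (\<forall>i<k. \<forall>j\<in>V. A i j \<in> {1..d}) \<and>
             real (card (uncovered k V t W A)) \<le> real ((card V choose t) * card W) / b ^ k"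
proof (rule ccontr)
  assume contr: "\<not> ?thesis"
  define R where "R = V \<rightarrow>\<^sub>E {1..d}"
  define X where "X = {..<k} \<rightarrow>\<^sub>E R"
  define P where "P = {C. C \<subseteq> V \<and> card C = t} \<times> W"
  define B where "B = real (card P) / b ^ k"
  have finP: "finite P" using V W by (auto simp: P_def)
  have cardP: "card P = (card V choose t) * card W"
    using V by (simp add: P_def card_cartesian_product n_subsets)
  have finR: "finite R" using V by (auto simp: R_def intro: finite_PiE)
  have finX: "finite X" using finR by (auto simp: X_def intro: finite_PiE)
  have cardR: "card R = d ^ card V" using V by (simp add: R_def card_PiE)
  have cardX: "card X = card R ^ k" by (simp add: X_def card_PiE)
  have Xpos: "card X > 0" using d by (simp add: cardX cardR)
  have unc: "uncovered k V t W A = {p \<in> P. \<forall>i<k. row_weight A i (fst p) \<noteq> snd p}" for A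
    by (auto simp: uncovered_def P_def)
  have big: "B < real (card (uncovered k V t W A))" if "A \<in> X" for A
  proof -
    have "\<forall>i<k. \<forall>j\<in>V. A i j \<in> {1..d}"
      using that by (auto simp: X_def R_def PiE_iff)
    then show ?thesis using contr unfolding B_def cardP by (meson not_le)
  qed
  have few: "real (card {A \<in> X. \<forall>i<k. row_weight A i (fst p) \<noteq> snd p}) \<le> real (card X) / b ^ k"
    if "p \<in> P" for p
  proof -
    obtain C w where p: "p = (C, w)" by (cases p)
    have C: "C \<subseteq> V" "card C = t" and w: "w \<in> W"
      using that by (simp_all add: P_def p)
    let ?M = "{f \<in> R. sum f C \<noteq> w}"
    \<comment> \<open>Independence of the rows: the arrays missing \<open>w\<close> on \<open>C\<close> form a product over the rows.\<close>
    have "{A \<in> X. \<forall>i<k. row_weight A i C \<noteq> w} = {..<k} \<rightarrow>\<^sub>E ?M"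
      unfolding X_def row_weight_def PiE_iff lessThan_iff mem_Collect_eq set_eq_iff by blast
    then have eq: "card {A \<in> X. \<forall>i<k. row_weight A i C \<noteq> w} = card ?M ^ k"
      by (simp add: card_PiE)
    have tV: "t \<le> card V" using C V card_mono by metis
    have "card {g \<in> C \<rightarrow>\<^sub>E {1..d}. sum g C = w} \<le> card (C \<rightarrow>\<^sub>E {1..d})"
      using C V by (intro card_mono finite_PiE) (auto intro: finite_subset)
    then have nw: "num_words d t w \<le> d ^ t"
      using C V finite_subset[of C V] by (simp add: card_words_of_weight card_PiE del: One_nat_def)
    have "b * real (card ?M) = b * (real d ^ t - real (num_words d t w)) * real d ^ (card V - t)"
      using card_rows_missing_weight[OF V C(1), of d w] nw C(2)
      by (simp add: R_def of_nat_diff)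
    also have "\<dots> \<le> real d ^ t * real d ^ (card V - t)"
      using freq[OF w] by (intro mult_right_mono) auto
    also have "\<dots> = real (card R)"
      using tV by (simp add: cardR flip: power_add)
    finally have "real (card ?M) \<le> real (card R) / b"
      using b by (simp add: field_simps)
    then have "real (card ?M) ^ k \<le> (real (card R) / b) ^ k"
      by (intro power_mono) auto
    then show ?thesis by (simp add: p eq cardX power_divide)
  qed
  have "B * real (card X) = (\<Sum>A\<in>X. B)" by simp
  also have "\<dots> < (\<Sum>A\<in>X. real (card (uncovered k V t W A)))"
    using big finX Xpos by (intro sum_strict_mono) auto
  also have "\<dots> = real (\<Sum>A\<in>X. \<Sum>p\<in>{p \<in> P. \<forall>i<k. row_weight A i (fst p) \<noteq> snd p}. 1)"
    by (simp add: unc)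
  also have "\<dots> = real (\<Sum>p\<in>P. \<Sum>A\<in>{A \<in> X. \<forall>i<k. row_weight A i (fst p) \<noteq> snd p}. 1)"
    by (subst sum.swap_restrict[OF finX finP]) simp
  also have "\<dots> = (\<Sum>p\<in>P. real (card {A \<in> X. \<forall>i<k. row_weight A i (fst p) \<noteq> snd p}))"
    by simp
  also have "\<dots> \<le> (\<Sum>p\<in>P. real (card X) / b ^ k)"
    using few by (intro sum_mono) auto
  also have "\<dots> = B * real (card X)" by (simp add: B_def)
  finally show False by simp
qed

section \<open>Deleting columns and adding constant rows\<close>

text \<open>
  A column set that avoids all deleted columns belongs to no uncovered pair, because each
  uncovered pair has lost a column.  Weights divisible by \<open>t\<close> are left to the constant rows.
\<close>

lemma k0_le_of_few_uncovered:
  assumes t: "t \<ge> 1" and V: "finite V"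
    and W: "W = {w \<in> {t..d * t}. \<not> t dvd w}"
    and A: "\<forall>i<k. \<forall>j\<in>V. A i j \<in> {1..d}"
    and few: "n + card (uncovered k V t W A) \<le> card V"
  shows "k0 n t d \<le> k + d"
proof -
  let ?U = "uncovered k V t W A"
  define D where "D = (\<lambda>(C, w). SOME c. c \<in> C) ` ?U"
  have "?U \<subseteq> Pow V \<times> W" by (auto simp: uncovered_def)
  then have finU: "finite ?U" using V W by (elim finite_subset) simp
  have D: "\<exists>c\<in>C. c \<in> D" if "(C, w) \<in> ?U" for C w
  proof -
    have "C \<noteq> {}" using that t by (auto simp: uncovered_def)
    then have "(SOME c. c \<in> C) \<in> C" by (simp add: some_in_eq)
    moreover have "(SOME c. c \<in> C) \<in> D" using that by (force simp: D_def)
    ultimately show ?thesis by blast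
  qed
  have "card D \<le> card ?U" unfolding D_def by (rule card_image_le[OF finU])
  then have "card {..<n} \<le> card (V - D)"
    using few diff_card_le_card_Diff[of D V] finU by (simp add: D_def)
  then obtain \<phi> where \<phi>: "inj_on \<phi> {..<n}" "\<phi> ` {..<n} \<subseteq> V - D"
    using V card_le_inj[of "{..<n}" "V - D"] by auto
  \<comment> \<open>The first \<open>k\<close> rows are those of \<open>A\<close> on surviving columns; row \<open>k + (a - 1)\<close> is constantly \<open>a\<close>.\<close>
  define A' where "A' i j = (if i < k then A i (\<phi> j) else i - k + 1)" for i j
  have "weight_covering_array (k + d) n t d A'"
    unfolding weight_covering_array_def
  proof (intro conjI allI impI ballI)
    show "array_over (k + d) n d A'"
      using A \<phi>(2) by (auto simp: array_over_def A'_def image_subset_iff)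
    fix C w assume C: "C \<subseteq> {..<n} \<and> card C = t" and w: "w \<in> {t..d * t}"
    show "\<exists>i<k + d. row_weight A' i C = w"
    proof (cases "t dvd w")
      case True
      then obtain a where a: "w = t * a" by blast
      with w t have "1 \<le> a" "a \<le> d" by (auto simp: mult.commute)
      moreover have "A' (k + (a - 1)) j = a" for j
        using \<open>1 \<le> a\<close> by (auto simp: A'_def)
      then have "row_weight A' (k + (a - 1)) C = w"
        using C by (simp add: row_weight_def a)
      ultimately show ?thesis by (intro exI[of _ "k + (a - 1)"]) auto
    next
      case False
      have inj: "inj_on \<phi> C" using \<phi>(1) C inj_on_subset by blast
      have "\<phi> ` C \<subseteq> V - D" using \<phi>(2) C by blast
      then have "(\<phi> ` C, w) \<notin> ?U" using D by blast
      then obtain i where i: "i < k" "row_weight A i (\<phi> ` C) = w"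
        using \<open>\<phi> ` C \<subseteq> V - D\<close> C w W False inj by (auto simp: uncovered_def card_image)
      then have "row_weight A' i C = w"
        using inj by (simp add: row_weight_def A'_def sum.reindex)
      then show ?thesis using i(1) by (intro exI[of _ i]) auto
    qed
  qed
  then show ?thesis unfolding k0_def by (intro Least_le) blast
qed

text \<open>
  With \<open>2 * n\<close> columns there are at most \<open>(2 * n) ^ t * (d * t)\<close> pairs, that is \<open>n\<close> times the
  argument of the logarithm.  So once \<open>b ^ k\<close> reaches that argument, at most \<open>n\<close> pairs are
  expected to be uncovered, and \<open>n\<close> columns survive.  The summand \<open>d + 1\<close> pays for the constant
  rows and for rounding \<open>k\<close> up to an integer.
\<close>

lemma k0_le_log:
  fixes b :: real
  assumes t: "t \<ge> 1" and d: "d \<ge> 1" and b: "b > 1" and n: "n \<ge> 1"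
    and freq: "\<And>w. w \<in> {t..d * t} \<Longrightarrow> \<not> t dvd w \<Longrightarrow>
                 b * (real d ^ t - real (num_words d t w)) \<le> real d ^ t"
  shows "real (k0 n t d) \<le> log b (real (2 ^ t * (d * t) * n ^ (t - 1))) + real (d + 1)"
proof -
  define K where "K = real (2 ^ t * (d * t) * n ^ (t - 1))"
  define W where "W = {w \<in> {t..d * t}. \<not> t dvd w}"
  define k where "k = nat \<lceil>log b K\<rceil>"
  have "2 ^ t * (d * t) * n ^ (t - 1) \<ge> 1" using t d n by simp
  then have K1: "K \<ge> 1" unfolding K_def by (metis of_nat_1 of_nat_le_iff)
  have k_le: "real k \<le> log b K + 1"
    using K1 b by (simp add: k_def)
  have Kbk: "K \<le> b ^ k"
  proof -
    have "log b K \<le> real k" unfolding k_def by linarith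
    then show ?thesis using K1 b by (simp add: log_le_iff powr_realpow)
  qed
  obtain A where A: "\<forall>i<k. \<forall>j\<in>{..<2 * n}. A i j \<in> {1..d}"
    and few: "real (card (uncovered k {..<2 * n} t W A))
                \<le> real ((card {..<2 * n} choose t) * card W) / b ^ k"
    using exists_array_few_uncovered[of "{..<2 * n}" W d b t k] d b freq
    by (auto simp: W_def)
  have choose_le: "2 * n choose t \<le> (2 * n) ^ t"
    using binomial_le_pow[of t "2 * n"] by (cases "t \<le> 2 * n") (simp_all add: binomial_eq_0)
  have "card W \<le> card {1..d * t}"
    using t by (intro card_mono) (auto simp: W_def)
  then have "(2 * n choose t) * card W \<le> (2 * n) ^ t * (d * t)"
    by (intro mult_mono choose_le) auto
  then have "real ((2 * n choose t) * card W) \<le> real ((2 * n) ^ t * (d * t))"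
    by (rule of_nat_mono)
  also have "\<dots> = real n * K"
  proof -
    have "n ^ t = n * n ^ (t - 1)" using t by (cases t) auto
    then show ?thesis by (simp add: K_def power_mult_distrib)
  qed
  also have "\<dots> \<le> real n * b ^ k" using Kbk by (intro mult_left_mono) auto
  finally have "real ((2 * n choose t) * card W) / b ^ k \<le> real n"
    using b by (subst pos_divide_le_eq) auto
  with few have "real (card (uncovered k {..<2 * n} t W A)) \<le> real n" by simp
  then have "k0 n t d \<le> k + d"
    using t A by (intro k0_le_of_few_uncovered[of t "{..<2 * n}" W d k A n]) (auto simp: W_def)
  then show ?thesis using k_le unfolding K_def by linarith
qed

text \<open>
  The additive constant \<open>L\<close>, which does not depend on \<open>n\<close>, is absorbed by the factor
  \<open>1 + o(1)\<close>.
\<close>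

lemma asymp_le_k0:
  fixes b c :: real
  assumes t: "t \<ge> 2" and d: "d \<ge> 1" and b: "b > 1"
    and freq: "\<And>w. w \<in> {t..d * t} \<Longrightarrow> \<not> t dvd w \<Longrightarrow>
                 b * (real d ^ t - real (num_words d t w)) \<le> real d ^ t"
    and c: "real (t - 1) \<le> c * log 2 b"
  shows "asymp_le (\<lambda>n. real (k0 n t d)) (\<lambda>n. c * log 2 (real n))"
proof -
  define L where "L = log b (real (2 ^ t * (d * t))) + real (d + 1)"
  have lb: "log 2 b > 0" using b by simp
  have "0 < real (t - 1)" using t by simp
  then have "0 < c * log 2 b" using c by linarith
  then have cpos: "c > 0" using lb by (simp add: zero_less_mult_iff)
  have "real (k0 n t d) \<le> c * log 2 (real n) * (1 + L / (c * log 2 (real n)))" if n: "n \<ge> 2" for n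
  proof -
    have ln: "log 2 (real n) > 0" using n by simp
    have "real (k0 n t d) \<le> log b (real (2 ^ t * (d * t) * n ^ (t - 1))) + real (d + 1)"
      using t n by (intro k0_le_log d b freq) auto
    also have "\<dots> = L + real (t - 1) * log b (real n)"
      using t d b n by (simp add: L_def log_mult log_nat_power)
    also have "\<dots> \<le> L + c * log 2 (real n)"
    proof -
      have "real (t - 1) * log b (real n) = real (t - 1) * (log 2 (real n) / log 2 b)"
        using b by (simp add: log_def)
      also have "\<dots> \<le> (c * log 2 b) * (log 2 (real n) / log 2 b)"
        using c ln lb by (intro mult_right_mono divide_nonneg_pos) linarith+
      also have "\<dots> = c * log 2 (real n)" using lb by simp
      finally show ?thesis by simp
    qed
    also have "\<dots> = c * log 2 (real n) * (1 + L / (c * log 2 (real n)))"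
      using cpos ln by (simp add: distrib_left)
    finally show ?thesis .
  qed
  moreover have "(\<lambda>n. L / (c * log 2 (real n))) \<in> o(\<lambda>_. 1)"
  proof -
    have "filterlim (\<lambda>n. ln (real n)) at_top sequentially"
      by (rule filterlim_compose[OF ln_at_top filterlim_real_sequentially])
    moreover have "c / ln 2 > 0" using cpos by simp
    ultimately have "filterlim (\<lambda>n. c / ln 2 * ln (real n)) at_top sequentially"
      by (intro filterlim_tendsto_pos_mult_at_top[OF tendsto_const])
    then have "filterlim (\<lambda>n. c * log 2 (real n)) at_top sequentially"
      by (simp add: log_def)
    then have "(\<lambda>n. L / (c * log 2 (real n))) \<longlonglongrightarrow> 0"
      by (intro real_tendsto_divide_at_top[OF tendsto_const])
    then show ?thesis by (intro smalloI_tendsto) auto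
  qed
  ultimately show ?thesis
    unfolding asymp_le_def
    by (intro exI[of _ "\<lambda>n. L / (c * log 2 (real n))"] conjI eventually_at_top_linorderI[of 2])
qed

section \<open>The numerical values\<close>

lemma le_mult_log2:
  fixes b :: real
  assumes "b > 0" "2 ^ m \<le> b ^ q"
  shows "real m \<le> real q * log 2 b"
  using le_log_of_power[OF assms(2)] assms(1) by (simp add: log_nat_power)

text \<open>
  The premise \<open>t > 0\<close> in place of a successor lets these equations rewrite terms in which \<open>t\<close> is
  a numeral.
\<close>

lemma num_words_binary:
  assumes "t > 0"
  shows "num_words 2 t w = (if 1 \<le> w then num_words 2 (t - 1) (w - 1) else 0)
           + (if 2 \<le> w then num_words 2 (t - 1) (w - 2) else 0)"
proof -
  have "{1..2} = {1, 2::nat}" by auto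
  then show ?thesis using assms by (cases t) simp_all
qed

lemma num_words_ternary:
  assumes "t > 0"
  shows "num_words 3 t w = (if 1 \<le> w then num_words 3 (t - 1) (w - 1) else 0)
           + (if 2 \<le> w then num_words 3 (t - 1) (w - 2) else 0)
           + (if 3 \<le> w then num_words 3 (t - 1) (w - 3) else 0)"
proof -
  have "{1..3} = {1, 2, 3::nat}" by auto
  then show ?thesis using assms by (cases t) simp_all
qed

theorem corollary3p2:
  shows "asymp_le (\<lambda>n. real (k0 n 3 2)) (\<lambda>n. 2.95 * log 2 (real n)) \<and>
         asymp_le (\<lambda>n. real (k0 n 4 2)) (\<lambda>n. 7.23 * log 2 (real n)) \<and>
         asymp_le (\<lambda>n. real (k0 n 3 3)) (\<lambda>n. 11.77 * log 2 (real n))"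
proof (intro conjI)
  show "asymp_le (\<lambda>n. real (k0 n 3 2)) (\<lambda>n. 2.95 * log 2 (real n))"
  proof (rule asymp_le_k0[where b = "8/5"])
    have "num_words 2 3 4 = 3" "num_words 2 3 5 = 3"
      by (simp_all add: num_words_binary del: num_words.simps(2))
    moreover fix w :: nat assume "w \<in> {3..2 * 3}" "\<not> 3 dvd w"
    then have "w \<in> {4, 5}" by simp presburger
    ultimately show "8/5 * (real 2 ^ 3 - real (num_words 2 3 w)) \<le> real 2 ^ 3"
      by auto
  next
    show "real (3 - 1) \<le> 2.95 * log 2 (8/5)"
      using le_mult_log2[of "8/5" 40 59] by (simp add: power_divide)
  qed auto
  show "asymp_le (\<lambda>n. real (k0 n 4 2)) (\<lambda>n. 7.23 * log 2 (real n))"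
  proof (rule asymp_le_k0[where b = "4/3"])
    have "num_words 2 4 5 = 4" "num_words 2 4 6 = 6" "num_words 2 4 7 = 4"
      by (simp_all add: num_words_binary del: num_words.simps(2))
    moreover fix w :: nat assume "w \<in> {4..2 * 4}" "\<not> 4 dvd w"
    then have "w \<in> {5, 6, 7}" by simp presburger
    ultimately show "4/3 * (real 2 ^ 4 - real (num_words 2 4 w)) \<le> real 2 ^ 4"
      by auto
  next
    show "real (4 - 1) \<le> 7.23 * log 2 (4/3)"
      using le_mult_log2[of "4/3" 300 723] by (simp add: power_divide)
  qed auto
  show "asymp_le (\<lambda>n. real (k0 n 3 3)) (\<lambda>n. 11.77 * log 2 (real n))"
  proof (rule asymp_le_k0[where b = "9/8"])
    have "num_words 3 3 4 = 3" "num_words 3 3 5 = 6" "num_words 3 3 7 = 6" "num_words 3 3 8 = 3"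
      by (simp_all add: num_words_ternary del: num_words.simps(2))
    moreover fix w :: nat assume "w \<in> {3..3 * 3}" "\<not> 3 dvd w"
    then have "w \<in> {4, 5, 7, 8}" by simp presburger
    ultimately show "9/8 * (real 3 ^ 3 - real (num_words 3 3 w)) \<le> real 3 ^ 3"
      by auto
  next
    \<comment> \<open>11.77 exceeds \<open>2 / log 2 (9/8)\<close> by about one part in 100000 only; the fraction 1054/665
      is the first continued fraction convergent of \<open>log 2 3\<close> from below that is this accurate.\<close>
    have "1054 \<le> 665 * log 2 (3::real)"
      using le_mult_log2[of 3 1054 665] by simp
    moreover have "log 2 (9/8 :: real) = 2 * log 2 3 - 3"
      using log_nat_power[of 3 2 2] log_nat_power[of 2 2 3] by (simp add: log_divide)
    ultimately show "real (3 - 1) \<le> 11.77 * log 2 (9/8)"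
      by simp
  qed auto
qed

end
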